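(* Let $G=(V,\mathcal E)$ be an undirected connected graph on $n$ nodes. For each link $e=\{i,j\}$ let $E_e=e_i-e_j$, and fix a time-delay $\tau\ge0$. For a weight vector $w=(w(e))_{e\in\mathcal E}$, let $L(w)=\sum_{e\in\mathcal E}w(e)E_eE_e^T$. Call $w$ admissible if $w(e)>0$ for all $e$ and $\tau\lambda_n(L(w))<\pi/2$. Consider the dynamics-noise network $$\dot x(t)=-L(w)x(t-\tau)+\xi(t),\qquad y=M_nx,$$ with $\xi_1,\dots,\xi_n$ mutually independent zero-mean Gaussian white noises of intensities $\sigma_1^2,\dots,\sigma_n^2$. Its agent centralities are $$\eta_i(w)=\frac12\big[L^\dagger\cos(\tau L)(M_n-\sin(\tau L))^\dagger\big]_{ii},\qquad L=L(w).$$ Consider the two problems: - (P1) minimize over admissible $w$ the quantity $\max_{i\in V}\eta_i(w)$; - (P2) minimize over admissible $w$ the quantity $\max\{\rho_{ss}(L(w);\tau;\sigma):\ \sigma_i\ge0,\ \sum_{i=1}^n\sigma_i^2=n\}$. Then (P1) and (P2) are equivalent: an admissible weight vector is optimal for (P1) if and only if it is optimal for (P2). That is, minimizing the worst-case agent centrality index is equivalent to designing the network that is most robust against an adversarial noise allocation of bounded total power.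
   Context: Notation: - $M_n=I_n-\frac1n\mathbf1\mathbf1^T$. - $X^\dagger$ is the Moore–Penrose pseudo-inverse. - $\cos(X)$ and $\sin(X)$ are the matrix power-series functions. - $\lambda_n(L)$ is the largest eigenvalue of $L$. The performance is $$\rho_{ss}(L;\tau;\sigma)=\lim_{t\to\infty}\mathbb E[y^Ty]=\frac1{2\pi}\int\mathrm{Tr}[G(j\omega)^HG(j\omega)]d\omega,\qquad G(s)=M_n(sI+e^{-\tau s}L)^{-1}\mathrm{diag}(\sigma_1,\dots,\sigma_n).$$ The centrality index is $\eta_i=\partial\rho_{ss}/\partial\sigma_i^2$. *)

theory Defs
  imports "HOL-Analysis.Analysis"
begin

text \<open>Matrices over the node type 'n (nodes = elements of 'n, n = CARD('n)).\<close>

primrec mpow :: "'a::semiring_1^'n^'n \<Rightarrow> nat \<Rightarrow> 'a^'n^'n" where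
  "mpow X 0 = mat 1"
| "mpow X (Suc k) = X ** mpow X k"

definition mat_cos :: "real^'n^'n \<Rightarrow> real^'n^'n" where
  "mat_cos X = (\<Sum>k. ((-1) ^ k / fact (2 * k)) *\<^sub>R mpow X (2 * k))"

definition mat_sin :: "real^'n^'n \<Rightarrow> real^'n^'n" where
  "mat_sin X = (\<Sum>k. ((-1) ^ k / fact (2 * k + 1)) *\<^sub>R mpow X (2 * k + 1))"

definition pinv :: "real^'n^'n \<Rightarrow> real^'n^'n" where
  "pinv A = (THE X. A ** X ** A = A \<and> X ** A ** X = X \<and>
                    transpose (A ** X) = A ** X \<and> transpose (X ** A) = X ** A)"

definition Mc :: "'a::field^'n^'n" where
  "Mc = mat 1 - (\<chi> i j. 1 / of_nat CARD('n))"

definition lambda_max :: "real^'n^'n \<Rightarrow> real" where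
  "lambda_max A = Max {l. \<exists>v. v \<noteq> 0 \<and> A *v v = l *\<^sub>R v}"

definition simple_graph :: "'n set set \<Rightarrow> bool" where
  "simple_graph E \<longleftrightarrow> (\<forall>e\<in>E. \<exists>i j. i \<noteq> j \<and> e = {i, j})"

definition connected_graph :: "'n set set \<Rightarrow> bool" where
  "connected_graph E \<longleftrightarrow> (\<forall>i j. (\<lambda>a b. {a, b} \<in> E)\<^sup>*\<^sup>* i j)"

text \<open>E_e = e_i - e_j for e = {i,j} (some fixed orientation; L(w) does not depend on it).\<close>
definition edge_vec :: "'n set \<Rightarrow> real^'n" where
  "edge_vec e = (let (i, j) = (SOME (i, j). i \<noteq> j \<and> e = {i, j}) in axis i 1 - axis j 1)"

definition outer :: "real^'n \<Rightarrow> real^'n \<Rightarrow> real^'n^'n" where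
  "outer u v = (\<chi> i j. u $ i * v $ j)"

definition Lap :: "('n::finite) set set \<Rightarrow> ('n set \<Rightarrow> real) \<Rightarrow> real^'n^'n" where
  "Lap E w = (\<Sum>e\<in>E. w e *\<^sub>R outer (edge_vec e) (edge_vec e))"

definition admissible :: "('n::finite) set set \<Rightarrow> real \<Rightarrow> ('n set \<Rightarrow> real) \<Rightarrow> bool" where
  "admissible E \<tau> w \<longleftrightarrow> (\<forall>e\<in>E. w e > 0) \<and> \<tau> * lambda_max (Lap E w) < pi / 2"

definition eta :: "('n::finite) set set \<Rightarrow> real \<Rightarrow> ('n set \<Rightarrow> real) \<Rightarrow> 'n \<Rightarrow> real" where
  "eta E \<tau> w i = (let L = Lap E w in
     (1/2) * (pinv L ** mat_cos (\<tau> *\<^sub>R L) ** pinv (Mc - mat_sin (\<tau> *\<^sub>R L))) $ i $ i)"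

definition cmat :: "real^'n^'n \<Rightarrow> complex^'n^'n" where
  "cmat A = (\<chi> i j. complex_of_real (A $ i $ j))"

definition transfer :: "real^'n^'n \<Rightarrow> real \<Rightarrow> real^'n \<Rightarrow> complex \<Rightarrow> complex^'n^'n" where
  "transfer L \<tau> \<sigma> s = Mc ** matrix_inv (mat s + mat (exp (- of_real \<tau> * s)) ** cmat L)
                         ** (\<chi> i j. if i = j then complex_of_real (\<sigma> $ i) else 0)"

definition conj_transpose :: "complex^'n^'n \<Rightarrow> complex^'n^'n" where
  "conj_transpose A = (\<chi> i j. cnj (A $ j $ i))"

definition rho_ss :: "real^'n^'n \<Rightarrow> real \<Rightarrow> real^'n \<Rightarrow> real" where
  "rho_ss L \<tau> \<sigma> = 1 / (2 * pi) *
     (LINT \<omega>|lborel. Re (trace (conj_transpose (transfer L \<tau> \<sigma> (\<i> * of_real \<omega>))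
                                  ** transfer L \<tau> \<sigma> (\<i> * of_real \<omega>))))"

definition worst_eta :: "('n::finite) set set \<Rightarrow> real \<Rightarrow> ('n set \<Rightarrow> real) \<Rightarrow> real" where
  "worst_eta E \<tau> w = Max (range (eta E \<tau> w))"

definition worst_rho :: "('n::finite) set set \<Rightarrow> real \<Rightarrow> ('n set \<Rightarrow> real) \<Rightarrow> real" where
  "worst_rho E \<tau> w = Sup {rho_ss (Lap E w) \<tau> \<sigma> | \<sigma>.
       (\<forall>i. \<sigma> $ i \<ge> 0) \<and> (\<Sum>i\<in>UNIV. (\<sigma> $ i)\<^sup>2) = real CARD('n)}"

definition optimal_P1 :: "('n::finite) set set \<Rightarrow> real \<Rightarrow> ('n set \<Rightarrow> real) \<Rightarrow> bool" where
  "optimal_P1 E \<tau> w \<longleftrightarrow> admissible E \<tau> w \<and>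
     (\<forall>w'. admissible E \<tau> w' \<longrightarrow> worst_eta E \<tau> w \<le> worst_eta E \<tau> w')"

definition optimal_P2 :: "('n::finite) set set \<Rightarrow> real \<Rightarrow> ('n set \<Rightarrow> real) \<Rightarrow> bool" where
  "optimal_P2 E \<tau> w \<longleftrightarrow> admissible E \<tau> w \<and>
     (\<forall>w'. admissible E \<tau> w' \<longrightarrow> worst_rho E \<tau> w \<le> worst_rho E \<tau> w')"

end

theory Submission
  imports Defs "HOL-Complex_Analysis.Cauchy_Integral_Formula" "HOL-Real_Asymp.Real_Asymp"
begin

text \<open>For admissible weights, \<open>\<rho>\<^sub>s\<^sub>s = \<Sum>\<^sub>i \<sigma>\<^sub>i\<^sup>2 \<eta>\<^sub>i\<close>. Maximising this linear function of the
  \<open>\<sigma>\<^sub>i\<^sup>2\<close> over the simplex \<open>\<Sum>\<^sub>i \<sigma>\<^sub>i\<^sup>2 = n\<close> gives \<open>n max\<^sub>i \<eta>\<^sub>i\<close>, so the two objectives are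
  proportional. To obtain the formula for \<open>\<rho>\<^sub>s\<^sub>s\<close>, diagonalise \<open>L\<close> in an orthonormal eigenbasis;
  each nonzero eigenvalue \<open>m\<close> contributes the integral of \<open>1 / |\<i>\<omega> + m exp (-\<i>\<tau>\<omega>)|\<^sup>2\<close> over the
  real line, which equals \<open>\<pi> cos (\<tau>m) / (m (1 - sin (\<tau>m)))\<close> by Cauchy's theorem on large right
  half-discs, where the delay characteristic function has no zeros because \<open>\<tau>m < \<pi>/2\<close>.\<close>

section \<open>Eigenbases of self-adjoint maps\<close>

text \<open>A maximiser \<open>v\<close> of \<open>x \<bullet> f x\<close> on the compact unit
  sphere of \<open>S\<close> is an eigenvector: the residual \<open>r = f v - M *\<^sub>R v\<close>
  lies in \<open>S\<close> and is orthogonal to \<open>v\<close>, and if it were nonzero, a small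
  move from \<open>v\<close> along \<open>r\<close> would violate maximality.\<close>

lemma self_adjoint_has_eigenvector:
  fixes f :: "'a::euclidean_space \<Rightarrow> 'a"
  assumes lin: "linear f" and adj: "\<And>x y. f x \<bullet> y = x \<bullet> f y"
    and S: "subspace S" and inv: "\<And>x. x \<in> S \<Longrightarrow> f x \<in> S" and ne: "S \<noteq> {0}"
  obtains v c where "v \<in> S" "norm v = 1" "f v = c *\<^sub>R v"
proof -
  let ?K = "S \<inter> sphere 0 1"
  obtain z where z: "z \<in> S" "z \<noteq> 0"
    using ne S subspace_0 by blast
  have "z /\<^sub>R norm z \<in> ?K"
    using z S by (simp add: subspace_scale)
  then have "?K \<noteq> {}" by blast
  moreover have "compact ?K"
    by (simp add: S closed_subspace compact_Int_closed closed_Int_compact)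
  moreover have "continuous_on ?K (\<lambda>x. x \<bullet> f x)"
    by (intro continuous_intros linear_continuous_on linear_conv_bounded_linear[THEN iffD1] lin)
  ultimately obtain v where v: "v \<in> ?K" and max: "\<And>u. u \<in> ?K \<Longrightarrow> u \<bullet> f u \<le> v \<bullet> f v"
    using continuous_attains_sup by metis
  define M where "M = v \<bullet> f v"
  have vv: "v \<bullet> v = 1"
    using v by (simp add: dot_square_norm)
  have le: "u \<bullet> f u \<le> M * (u \<bullet> u)" if "u \<in> S" for u
  proof (cases "u = 0")
    case False
    have "(u /\<^sub>R norm u) \<bullet> f (u /\<^sub>R norm u) \<le> M"
      unfolding M_def using that False S by (intro max) (simp add: subspace_scale)
    then show ?thesis
      using False by (simp add: linear_scale[OF lin] dot_square_norm field_simps power2_eq_square)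
  qed (simp add: linear_0[OF lin])
  define r where "r = f v - M *\<^sub>R v"
  have rS: "r \<in> S"
    unfolding r_def using v S inv by (simp add: subspace_diff subspace_scale)
  have rv: "r \<bullet> v = 0"
    using vv by (simp add: r_def inner_diff_left M_def inner_commute[of "f v" v])
  have rf: "r \<bullet> f v = r \<bullet> r"
    using rv by (simp add: r_def inner_diff_left inner_diff_right inner_commute)
  \<comment> \<open>This is \<open>le\<close> at \<open>v + t *\<^sub>R r\<close>. The terms of
    order zero cancel, which leaves a linear term in \<open>t\<close> against a quadratic
    one.\<close>
  have ineq: "2 * t * (r \<bullet> r) \<le> t\<^sup>2 * (M * (r \<bullet> r) - r \<bullet> f r)" for t
  proof -
    have "v + t *\<^sub>R r \<in> S"
      using v rS S by (simp add: subspace_add subspace_scale)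
    from le[OF this] show ?thesis
      using rv rf adj[of v r]
      by (simp add: linear_add[OF lin] linear_scale[OF lin] inner_add_left inner_add_right vv
          inner_commute[of v r] inner_commute[of "f v" r] M_def[symmetric] algebra_simps power2_eq_square)
  qed
  have "r \<bullet> r = 0"
  proof (rule ccontr)
    assume "r \<bullet> r \<noteq> 0"
    then have pos: "r \<bullet> r > 0" by simp
    \<comment> \<open>\<open>C\<close> dominates the quadratic coefficient and is positive thanks to
      the added 1. With \<open>t = (r \<bullet> r) / C\<close> the inequality becomes
      \<open>2 * t * (r \<bullet> r) \<le> t * (r \<bullet> r)\<close>.\<close>
    define C where "C = \<bar>M * (r \<bullet> r) - r \<bullet> f r\<bar> + 1"
    have C: "C > 0" "M * (r \<bullet> r) - r \<bullet> f r \<le> C" by (auto simp: C_def)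
    define t where "t = (r \<bullet> r) / C"
    have t: "t > 0" using pos C by (simp add: t_def)
    have "2 * t * (r \<bullet> r) \<le> t\<^sup>2 * C"
      using ineq[of t] mult_left_mono[OF C(2), of "t\<^sup>2"] by simp
    also have "\<dots> = t * (r \<bullet> r)"
      using C by (simp add: t_def power2_eq_square)
    finally show False using t pos by simp
  qed
  then have "f v = M *\<^sub>R v" by (simp add: r_def)
  with v show thesis by (intro that) auto
qed

text \<open>Take an orthonormal set of eigenvectors of greatest cardinality; it exists because such
  sets are independent. Self-adjointness makes its orthogonal complement invariant, so a nonzero
  complement would contain one more unit eigenvector.\<close>

lemma self_adjoint_orthonormal_eigenbasis:
  fixes f :: "'a::euclidean_space \<Rightarrow> 'a"
  assumes lin: "linear f" and adj: "\<And>x y. f x \<bullet> y = x \<bullet> f y"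
  obtains B \<mu> where "finite B"
    "\<And>b c. b \<in> B \<Longrightarrow> c \<in> B \<Longrightarrow> b \<bullet> c = (if b = c then 1 else 0)"
    "\<And>b. b \<in> B \<Longrightarrow> f b = \<mu> b *\<^sub>R b"
    "\<And>x. (\<Sum>b\<in>B. (x \<bullet> b) *\<^sub>R b) = x"
proof -
  define P where "P B \<longleftrightarrow> finite B \<and> (\<forall>b\<in>B. \<forall>c\<in>B. b \<bullet> c = (if b = c then 1 else 0)) \<and>
    (\<forall>b\<in>B. \<exists>c. f b = c *\<^sub>R b)" for B
  have bound: "card B < Suc (DIM('a))" if "P B" for B
  proof -
    have "independent B"
      using that by (intro pairwise_orthogonal_independent)
        (force simp: P_def pairwise_def orthogonal_def)+
    then show ?thesis by (simp add: independent_bound less_Suc_eq_le)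
  qed
  have "P {}" by (simp add: P_def)
  then obtain B where B: "P B" and max: "\<And>C. P C \<Longrightarrow> card C \<le> card B"
    using ex_has_greatest_nat[of P "{}" card "Suc DIM('a)"] bound by (metis less_imp_le)
  define S where "S = {x. \<forall>b\<in>B. x \<bullet> b = 0}"
  have S: "subspace S"
    by (auto simp: S_def subspace_def inner_add_left)
  have inv: "f x \<in> S" if "x \<in> S" for x
  proof -
    have "f x \<bullet> b = 0" if "b \<in> B" for b
      using B \<open>x \<in> S\<close> that adj[of x b] by (auto simp: P_def S_def)
    then show ?thesis by (simp add: S_def)
  qed
  have "S = {0}"
  proof (rule ccontr)
    assume "S \<noteq> {0}"
    then obtain v c where v: "v \<in> S" "norm v = 1" "f v = c *\<^sub>R v"
      using self_adjoint_has_eigenvector[OF lin adj S inv] by blast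
    have vv: "v \<bullet> v = 1" using v by (simp add: dot_square_norm)
    then have "v \<notin> B" using v(1) by (force simp: S_def)
    moreover have "P (insert v B)"
      using B v vv \<open>v \<notin> B\<close> by (auto simp: P_def S_def inner_commute)
    ultimately show False
      using max[of "insert v B"] B by (simp add: P_def)
  qed
  \<comment> \<open>The difference between \<open>x\<close> and its projection is orthogonal to
    every element of \<open>B\<close>, hence lies in \<open>S = {0}\<close>.\<close>
  have expand: "(\<Sum>b\<in>B. (x \<bullet> b) *\<^sub>R b) = x" for x
  proof -
    have "(\<Sum>b\<in>B. (x \<bullet> b) * (b \<bullet> c)) = x \<bullet> c" if "c \<in> B" for c
    proof -
      have "(\<Sum>b\<in>B. (x \<bullet> b) * (b \<bullet> c)) = (\<Sum>b\<in>B. if b = c then x \<bullet> b else 0)"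
        using B that by (intro sum.cong) (auto simp: P_def)
      then show ?thesis using B that by (simp add: P_def)
    qed
    then have "x - (\<Sum>b\<in>B. (x \<bullet> b) *\<^sub>R b) \<in> S"
      by (auto simp: S_def inner_diff_left inner_sum_left)
    then show ?thesis using \<open>S = {0}\<close> by simp
  qed
  obtain \<mu> where "\<And>b. b \<in> B \<Longrightarrow> f b = \<mu> b *\<^sub>R b"
    using B unfolding P_def by metis
  with B expand show thesis
    by (intro that[of B \<mu>]) (auto simp: P_def)
qed

section \<open>The scalar delay integral\<close>

text \<open>The characteristic function of \<open>x' = -x(t - a)\<close>. A mode of eigenvalue
  \<open>m > 0\<close> reduces to it with \<open>a = \<tau> * m\<close> after scaling the frequency
  by \<open>m\<close>.\<close>

definition delay_symbol :: "real \<Rightarrow> complex \<Rightarrow> complex" where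
  "delay_symbol a s = s + exp (- of_real a * s)"

text \<open>In the right half-plane the exponential has modulus at most 1, so a zero would have
  \<open>\<bar>Im s\<bar> \<le> 1\<close>. Then \<open>a * Im s\<close> stays within
  \<open>(-pi/2, pi/2)\<close>, its cosine is positive, and the real part of the symbol cannot
  vanish.\<close>

lemma delay_symbol_nonzero:
  assumes a: "0 \<le> a" "a < pi / 2" and s: "Re s \<ge> 0"
  shows "delay_symbol a s \<noteq> 0"
proof
  assume "delay_symbol a s = 0"
  then have "Re (delay_symbol a s) = 0" "Im (delay_symbol a s) = 0" by simp_all
  then have re: "Re s + exp (- a * Re s) * cos (a * Im s) = 0"
    and im: "Im s = exp (- a * Re s) * sin (a * Im s)"
    by (simp_all add: delay_symbol_def Re_exp Im_exp)
  have "exp (- a * Re s) \<le> 1" using a s by simp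
  then have "\<bar>Im s\<bar> \<le> 1 * 1"
    by (subst im, subst abs_mult, intro mult_mono) auto
  then have "\<bar>a * Im s\<bar> \<le> a" using a by (simp add: abs_mult mult_left_le)
  then have "cos (a * Im s) > 0" using a by (intro cos_gt_zero_pi) linarith+
  then have "exp (- a * Re s) * cos (a * Im s) > 0" by simp
  with re s show False by simp
qed

section \<open>Contour integration of the scalar power spectrum\<close>

lemma sin_less_one_below_pi_half:
  fixes a :: real
  assumes "0 \<le> a" "a < pi / 2"
  shows "sin a < 1"
  using sin_monotone_2pi[of a "pi/2"] assms by simp

text \<open>Here \<open>F\<close> is the Laplace transform of the stationary autocovariance, restricted to
  nonnegative lags, of the scalar equation \<open>x' = -x(t - a) + \<xi>\<close>, and \<open>A\<close> is the stationary
  variance. The real part of \<open>F\<close> on the imaginary axis is half the power spectrum, and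
  \<open>F(s) \<sim> A / s\<close> at infinity. The value of \<open>A\<close> is the one that makes the singularities
  at \<open>\<plusminus>\<i>\<close> removable.\<close>

lemma one_sided_spectrum_holomorphic:
  fixes a :: real
  assumes a: "0 \<le> a" "a < pi / 2"
  defines "A \<equiv> cos a / (2 * (1 - sin a))"
  defines "Q \<equiv> \<lambda>s. of_real A * s + (exp (- of_real a * s) - s) / (2 * delay_symbol a s)"
  obtains F where "F holomorphic_on {s. delay_symbol a s \<noteq> 0}"
    "\<And>s. s \<noteq> \<i> \<Longrightarrow> s \<noteq> -\<i> \<Longrightarrow> F s = Q s / (s\<^sup>2 + 1)"
proof -
  define U where "U = {s. delay_symbol a s \<noteq> 0}"
  have U: "open U"
    unfolding U_def delay_symbol_def by (intro open_Collect_neq continuous_intros)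
  have iU: "\<i> \<in> U" "-\<i> \<in> U"
    using delay_symbol_nonzero[OF a] by (auto simp: U_def)
  have h: "delay_symbol a holomorphic_on U"
    unfolding delay_symbol_def by (intro holomorphic_intros)
  have hol: "Q holomorphic_on U"
    unfolding Q_def
    by (intro holomorphic_intros h) (auto simp: U_def)
  have sin: "1 - sin a \<noteq> 0"
    using sin_less_one_below_pi_half[OF a] by simp
  have A1: "2 * A * (1 - sin a) = cos a"
    using sin by (simp add: A_def divide_simps)
  \<comment> \<open>The second form \<open>A = (1 + sin a) / (2 cos a)\<close>, stated without
    division. \<open>A1\<close> kills the real part and \<open>A2\<close> the imaginary part of the
    numerator of \<open>Q\<close> at \<open>\<i>\<close>.\<close>
  have "2 * A * cos a * (1 - sin a) = cos a * (2 * A * (1 - sin a))" by simp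
  also have "\<dots> = (1 + sin a) * (1 - sin a)"
    using sin_cos_squared_add[of a] unfolding A1 by (simp add: power2_eq_square algebra_simps)
  finally have A2: "2 * A * cos a = 1 + sin a"
    using sin by simp
  have Qi: "Q \<i> = 0"
  proof -
    have "exp (- of_real a * \<i>) = Complex (cos a) (- sin a)"
      by (simp add: complex_eq_iff Re_exp Im_exp)
    moreover have "cos a = A * (2 - 2 * sin a)" "A * (2 * cos a) - sin a = 1"
      using A1 A2 by argo+
    ultimately have "of_real A * \<i> * (2 * delay_symbol a \<i>) + (exp (- of_real a * \<i>) - \<i>) = 0"
      by (simp add: delay_symbol_def complex_eq_iff)
    then show ?thesis
      using iU(1) by (simp add: Q_def U_def field_simps)
  qed
  \<comment> \<open>All coefficients of \<open>Q\<close> are real, so its zeros come in conjugate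
    pairs.\<close>
  have "Q (cnj \<i>) = cnj (Q \<i>)"
    by (simp add: Q_def delay_symbol_def exp_cnj)
  then have Qmi: "Q (-\<i>) = 0" using Qi by simp
  \<comment> \<open>The zeros at \<open>\<i>\<close> and \<open>-\<i>\<close> are divided out one
    after the other; the difference quotients stay holomorphic when completed by the
    derivative.\<close>
  define G where "G = (\<lambda>z. if z = \<i> then deriv Q \<i> else (Q z - Q \<i>) / (z - \<i>))"
  have G: "G holomorphic_on U"
    unfolding G_def by (rule pole_lemma_open[OF hol U])
  define F where "F = (\<lambda>z. if z = -\<i> then deriv G (-\<i>) else (G z - G (-\<i>)) / (z - (-\<i>)))"
  have F: "F holomorphic_on U"
    unfolding F_def by (rule pole_lemma_open[OF G U])
  have "F s = Q s / (s\<^sup>2 + 1)" if "s \<noteq> \<i>" "s \<noteq> -\<i>" for s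
  proof -
    have "(s - \<i>) * (s + \<i>) = s\<^sup>2 + 1"
      by (simp add: algebra_simps power2_eq_square)
    then show ?thesis
      using that by (simp add: F_def G_def Qi Qmi eq_commute[of "-\<i>" \<i>])
  qed
  with F show thesis unfolding U_def by (rule that)
qed

text \<open>By Cauchy's theorem the integral of \<open>F\<close> up the imaginary segment equals
  that over the right half-circle. On the segment \<open>2 * Re F\<close> is the integrand; on the
  arc \<open>F\<close> is close to \<open>A / s\<close>, whose integral is
  \<open>\<i> * pi * A\<close>.\<close>

lemma truncated_delay_integral:
  fixes a R :: real
  assumes a: "0 \<le> a" "a < pi / 2" and R: "R \<ge> 2"
  defines "A \<equiv> cos a / (2 * (1 - sin a))"
  obtains J where "((\<lambda>x. 1 / (cmod (delay_symbol a (\<i> * of_real x)))\<^sup>2) has_integral J) {-R..R}"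
    "\<bar>J - 2 * pi * A\<bar> \<le> 2 * pi * ((A + 2) * R / (R\<^sup>2 - 1))"
proof -
  obtain F where F: "F holomorphic_on {s. delay_symbol a s \<noteq> 0}"
    and F_eq: "\<And>s. s \<noteq> \<i> \<Longrightarrow> s \<noteq> -\<i> \<Longrightarrow> F s =
      (of_real A * s + (exp (- of_real a * s) - s) / (2 * delay_symbol a s)) / (s\<^sup>2 + 1)"
    unfolding A_def using one_sided_spectrum_holomorphic[OF a] by blast
  have A: "A \<ge> 0"
    using sin_less_one_below_pi_half[OF a] cos_ge_zero[of a] a by (simp add: A_def)
  let ?H = "{s. Re s \<ge> 0}"
  let ?arc = "part_circlepath 0 R (-pi/2) (pi/2)"
  let ?line = "linepath (\<i> * of_real R) (- \<i> * of_real R)"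
  have nz: "delay_symbol a s \<noteq> 0" if "Re s \<ge> 0" for s
    using delay_symbol_nonzero[OF a that] .
  have holH: "F holomorphic_on ?H"
    using F by (rule holomorphic_on_subset) (auto simp: nz)
  have arc: "norm s = R \<and> Re s \<ge> 0" if "s \<in> path_image ?arc" for s
    using that R by (auto simp: path_image_part_circlepath' norm_mult closed_segment_eq_real_ivl
        intro!: mult_nonneg_nonneg cos_ge_zero)
  have line: "path_image ?line \<subseteq> ?H"
    by (auto simp: linepath_def path_image_def)
  have ends: "pathstart ?arc = -\<i> * of_real R" "pathfinish ?arc = \<i> * of_real R"
    by (simp_all add: cis_conv_exp[symmetric] complex_eq_iff exp_eq_polar cis.ctr)
  have "(F has_contour_integral 0) (?line +++ ?arc)"
    by (rule Cauchy_theorem_convex_simple[OF holH])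
       (use arc line ends in \<open>auto simp: convex_halfspace_Re_ge path_image_join\<close>)
  moreover have Fline: "F contour_integrable_on ?line"
    using holomorphic_on_imp_continuous_on[OF holH] line
    by (intro contour_integrable_continuous_linepath) (auto intro: continuous_on_subset simp del: path_image_linepath simp: path_image_linepath[symmetric])
  moreover have Farc: "F contour_integrable_on ?arc"
    using holomorphic_on_imp_continuous_on[OF holH] arc
    by (intro contour_integrable_continuous_part_circlepath) (auto intro: continuous_on_subset)
  ultimately have sum0: "contour_integral ?line F + contour_integral ?arc F = 0"
    using ends by (metis contour_integral_join contour_integral_unique pathfinish_linepath valid_path_linepath valid_path_part_circlepath)
  define I where "I = contour_integral ?arc F"
  have "(F has_contour_integral - I) ?line"
    using Fline sum0 unfolding I_def
    by (metis add_eq_0_iff2 has_contour_integral_integral)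
  then have "(F has_contour_integral I) (linepath (- \<i> * of_real R) (\<i> * of_real R))"
    using has_contour_integral_reversepath[of ?line F "-I"] by simp
  \<comment> \<open>On the upward segment \<open>ds = \<i> dx\<close>, so integrating
    \<open>F\<close> over \<open>x\<close> gives \<open>-\<i> * I\<close>, and twice the real part
    of that is \<open>2 * Im I\<close>.\<close>
  then have "((\<lambda>x. F (Complex 0 x)) has_integral (- \<i> * I)) {-R..R}"
    using R by (subst (asm) has_contour_integral_linepath_same_Re_iff[where c=0 and a="-R" and b=R]) auto
  then have "((\<lambda>x. 2 * Re (F (Complex 0 x))) has_integral 2 * Re (- \<i> * I)) {-R..R}"
    by (intro has_integral_mult_right has_integral_Re)
  then have J: "((\<lambda>x. 1 / (cmod (delay_symbol a (\<i> * of_real x)))\<^sup>2) has_integral 2 * Im I) {-R..R}"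
  \<comment> \<open>The explicit formula for \<open>F\<close> is only available away from
    \<open>\<i>\<close> and \<open>-\<i>\<close>, so the points \<open>x = 1\<close> and
    \<open>x = -1\<close> are left out.\<close>
  proof (subst (asm) has_integral_spike_finite_eq[where S = "{1, -1}"])
    fix x assume "x \<in> {-R..R} - {1, -1}"
    then have x: "x\<^sup>2 \<noteq> 1" by (auto simp: power2_eq_1_iff)
    define s where "s = \<i> * complex_of_real x"
    define e where "e = exp (- of_real a * s)"
    have s: "s \<noteq> \<i>" "s \<noteq> -\<i>" "Complex 0 x = s" "s\<^sup>2 + 1 = of_real (1 - x\<^sup>2)"
      using x by (auto simp: s_def complex_eq_iff power_mult_distrib)
    have "cmod e = 1" by (simp add: e_def s_def)
    then have e: "(Re e)\<^sup>2 + (Im e)\<^sup>2 = 1" by (simp add: cmod_def)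
    \<comment> \<open>As \<open>e\<close> has modulus 1 and \<open>s\<close> is imaginary, the
      numerator of the real part is \<open>1 - x\<^sup>2\<close>, which cancels the factor
      \<open>s\<^sup>2 + 1\<close>. The term in \<open>A * s\<close> is imaginary and drops
      out.\<close>
    have "(e - s) / (e + s) = (e - s) * cnj (e + s) / of_real ((cmod (e + s))\<^sup>2)"
      by (rule complex_div_cnj)
    then have "Re ((e - s) / (e + s)) = Re ((e - s) * cnj (e + s)) / (cmod (e + s))\<^sup>2"
      by (simp only: Re_divide_of_real)
    also have "Re ((e - s) * cnj (e + s)) = 1 - x\<^sup>2"
      using e by (simp add: s_def algebra_simps power2_eq_square)
    finally have "Re ((e - s) / (e + s)) = (1 - x\<^sup>2) / (cmod (e + s))\<^sup>2" .
    moreover have "2 * F s = (2 * of_real A * s + (e - s) / (e + s)) / of_real (1 - x\<^sup>2)"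
    proof -
      have "(e - s) / (2 * delay_symbol a s) = (e - s) / (e + s) / 2"
        by (simp add: delay_symbol_def e_def add.commute)
      then have "F s = (of_real A * s + (e - s) / (e + s) / 2) / of_real (1 - x\<^sup>2)"
        using F_eq[OF s(1,2)] unfolding s(4) e_def[symmetric] by simp
      moreover have "2 * ((u + q / 2) / c) = (2 * u + q) / c" for u q c :: complex
        by (simp add: add_divide_distrib distrib_left)
      ultimately show ?thesis by (simp only: mult.assoc)
    qed
    then have "Re (2 * F s) = Re (2 * of_real A * s + (e - s) / (e + s)) / (1 - x\<^sup>2)"
      by (simp only: Re_divide_of_real)
    ultimately have "Re (2 * F s) = 1 / (cmod (e + s))\<^sup>2"
      using x by (simp add: s_def)
    then show "1 / (cmod (delay_symbol a (\<i> * of_real x)))\<^sup>2 = 2 * Re (F (Complex 0 x))"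
      unfolding s(3) by (simp add: delay_symbol_def e_def s_def add.commute)
  qed auto
  have err: "cmod (I - of_real A * (\<i> * pi)) \<le> ((A + 2) / (R\<^sup>2 - 1)) * R * (pi/2 - (-pi/2))"
  proof (rule has_contour_integral_bound_part_circlepath)
    \<comment> \<open>On a circle about 0, \<open>ds / s = \<i> dt\<close>, so \<open>A / s\<close>
      pulls back to a constant over an angle \<open>pi\<close>.\<close>
    have "((\<lambda>t. of_real A * \<i>) has_integral of_real A * (\<i> * pi)) {-pi/2..pi/2}"
      using has_integral_const_real[of "of_real A * \<i>" "-pi/2" "pi/2"] by (simp add: scaleR_conv_of_real mult_ac)
    then have "((\<lambda>s. of_real A / s) has_contour_integral of_real A * (\<i> * pi)) ?arc"
      using R by (subst has_contour_integral_part_circlepath_iff) (auto simp: field_simps)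
    then show "((\<lambda>s. F s - of_real A / s) has_contour_integral (I - of_real A * (\<i> * pi))) ?arc"
      using has_contour_integral_integral[OF Farc] by (intro has_contour_integral_diff) (simp_all add: I_def)
    have R2: "R\<^sup>2 > 1" using R power_mono[of 2 R 2] by simp
    then show "0 \<le> (A + 2) / (R\<^sup>2 - 1)" using A by simp
    fix s assume "s \<in> path_image ?arc"
    then have s: "norm s = R" "Re s \<ge> 0" using arc by auto
    then have s': "s \<noteq> \<i>" "s \<noteq> -\<i>" "s \<noteq> 0" using R by auto
    define e where "e = exp (- of_real a * s)"
    have e: "cmod e \<le> 1" using a s by (simp add: e_def)
    have "cmod (e - s) \<le> R + 1" using norm_triangle_ineq4[of e s] e s by simp
    moreover have h: "cmod (s + e) \<ge> R - 1" using norm_diff_ineq[of s e] e s by simp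
    \<comment> \<open>\<open>R \<ge> 2\<close> gives \<open>(R + 1) / (R - 1) \<le> 3\<close>; the
      resulting 3/2 for \<open>q / 2\<close> is rounded up to the 2 in \<open>A + 2\<close>.\<close>
    ultimately have "cmod (e - s) / cmod (s + e) \<le> 3"
      using R by (simp add: divide_le_eq)
    moreover define q where "q = (e - s) / (s + e)"
    ultimately have "cmod q \<le> 3" by (simp add: norm_divide)
    moreover have "cmod (of_real A / s) \<le> A"
      using s R A by (simp add: norm_divide divide_le_eq mult_le_cancel_left1)
    ultimately have num: "cmod (q / 2 - of_real A / s) \<le> A + 2"
      using norm_triangle_ineq4[of "q / 2" "of_real A / s"] by simp
    have den: "cmod (s\<^sup>2 + 1) \<ge> R\<^sup>2 - 1"
      using norm_diff_ineq[of "s\<^sup>2" 1] s by (simp add: norm_power)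
    then have nz2: "s\<^sup>2 + 1 \<noteq> 0" using R2 by auto
    have "(e - s) / (2 * delay_symbol a s) = q / 2"
      by (simp add: delay_symbol_def e_def q_def)
    then have "F s = (of_real A * s + q / 2) / (s\<^sup>2 + 1)"
      using F_eq[OF s'(1,2)] unfolding e_def[symmetric] by simp
    \<comment> \<open>Over the common denominator \<open>s\<^sup>2 + 1\<close> the growing terms
      \<open>A * s\<close> cancel, and the remaining error is of order
      \<open>1 / R\<^sup>2\<close>.\<close>
    moreover have "of_real A / s = (of_real A * s + of_real A / s) / (s\<^sup>2 + 1)"
      using nz2 s'(3) by (simp add: divide_simps) (simp add: algebra_simps power2_eq_square)
    ultimately have "F s - of_real A / s =
        (of_real A * s + q / 2) / (s\<^sup>2 + 1) - (of_real A * s + of_real A / s) / (s\<^sup>2 + 1)"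
      by (rule arg_cong2[where f = minus])
    also have "\<dots> = (q / 2 - of_real A / s) / (s\<^sup>2 + 1)"
      by (simp add: diff_divide_distrib[symmetric])
    finally have "F s - of_real A / s = (q / 2 - of_real A / s) / (s\<^sup>2 + 1)" .
    also have "cmod \<dots> \<le> (A + 2) / (R\<^sup>2 - 1)"
      unfolding norm_divide using num den R2 A by (intro frac_le) auto
    finally show "cmod (F s - of_real A / s) \<le> (A + 2) / (R\<^sup>2 - 1)" .
  qed (use R in auto)
  have "2 * Im I - 2 * pi * A = 2 * Im (I - of_real A * (\<i> * pi))"
    by (simp add: algebra_simps)
  then have "\<bar>2 * Im I - 2 * pi * A\<bar> = 2 * \<bar>Im (I - of_real A * (\<i> * pi))\<bar>"
    by (simp only: abs_mult abs_numeral)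
  also have "\<dots> \<le> 2 * (((A + 2) / (R\<^sup>2 - 1)) * R * (pi/2 - (-pi/2)))"
    using order_trans[OF abs_Im_le_cmod err] by simp
  finally show thesis
    by (intro that[OF J]) (simp add: mult_ac)
qed

text \<open>The integrand is nonnegative, so monotone convergence along \<open>[-n, n]\<close>
  yields integrability together with the value; the truncation error is of order
  \<open>1 / n\<close>.\<close>

lemma delay_integral_unit:
  fixes a :: real
  assumes a: "0 \<le> a" "a < pi / 2"
  shows "has_bochner_integral lborel (\<lambda>x. 1 / (cmod (delay_symbol a (\<i> * of_real x)))\<^sup>2)
    (pi * cos a / (1 - sin a))"
proof -
  define A where "A = cos a / (2 * (1 - sin a))"
  define g where "g x = 1 / (cmod (delay_symbol a (\<i> * of_real x)))\<^sup>2" for x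
  have nz: "delay_symbol a (\<i> * of_real x) \<noteq> 0" for x
    by (rule delay_symbol_nonzero[OF a]) simp
  have cont: "continuous_on S g" for S
    unfolding g_def using nz unfolding delay_symbol_def by (intro continuous_intros) auto
  have int: "integrable lborel (\<lambda>x. indicator {- real n..real n} x * g x)" for n
    using borel_integrable_atLeastAtMost'[OF cont, of "- real n" "real n"] by (simp add: set_integrable_def)
  have bound: "\<bar>(LINT x|lborel. indicator {- real n..real n} x * g x) - 2 * pi * A\<bar>
      \<le> 2 * pi * ((A + 2) * real n / ((real n)\<^sup>2 - 1))" if "n \<ge> 2" for n
  proof -
    obtain J where J: "(g has_integral J) {- real n..real n}"
      "\<bar>J - 2 * pi * A\<bar> \<le> 2 * pi * ((A + 2) * real n / ((real n)\<^sup>2 - 1))"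
      using truncated_delay_integral[OF a, of "real n"] \<open>n \<ge> 2\<close> unfolding A_def g_def by force
    have "(LINT x|lborel. indicator {- real n..real n} x * g x) = integral {- real n..real n} g"
      using set_borel_integral_eq_integral(2)[OF borel_integrable_atLeastAtMost'[OF cont, of "- real n" "real n"]]
      by (simp add: set_lebesgue_integral_def)
    then show ?thesis using J by (simp add: integral_unique)
  qed
  have "(\<lambda>n. 2 * pi * ((A + 2) * real n / ((real n)\<^sup>2 - 1))) \<longlonglongrightarrow> 0"
    by real_asymp
  then have "(\<lambda>n. (LINT x|lborel. indicator {- real n..real n} x * g x) - 2 * pi * A) \<longlonglongrightarrow> 0"
    by (rule Lim_null_comparison[rotated]) (use bound in \<open>auto simp: eventually_sequentially\<close>)
  then have lim: "(\<lambda>n. LINT x|lborel. indicator {- real n..real n} x * g x) \<longlonglongrightarrow> 2 * pi * A"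
    by (simp add: LIM_zero_iff)
  have "has_bochner_integral lborel g (2 * pi * A)"
  proof (rule has_bochner_integral_monotone_convergence[OF int _ _ lim])
    show "AE x in lborel. mono (\<lambda>n. indicator {- real n..real n} x * g x)"
      by (auto simp: mono_def indicator_def g_def)
    have "\<forall>\<^sub>F n in sequentially. indicator {- real n..real n} x * g x = g x" for x
    proof -
      have "indicator {- real n..real n} x * g x = g x" if "n \<ge> nat \<lceil>\<bar>x\<bar>\<rceil>" for n
      proof -
        have "\<bar>x\<bar> \<le> real n" using that by linarith
        then show ?thesis by (auto simp: indicator_def)
      qed
      then show ?thesis unfolding eventually_sequentially by blast
    qed
    then show "AE x in lborel. (\<lambda>n. indicator {- real n..real n} x * g x) \<longlonglongrightarrow> g x"
      by (intro AE_I2 tendsto_eventually)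
    show "g \<in> borel_measurable lborel"
      using borel_measurable_continuous_onI[OF cont] by simp
  qed
  moreover have "2 * pi * A = pi * cos a / (1 - sin a)"
    using sin_less_one_below_pi_half[OF a] by (simp add: A_def divide_simps)
  ultimately show ?thesis by (simp add: g_def[abs_def])
qed

text \<open>Substituting \<open>m * x\<close> for the frequency takes a factor \<open>m\<close> out
  of the characteristic function. The squared modulus contributes \<open>1 / m\<^sup>2\<close> and
  the change of variable \<open>m\<close>.\<close>

lemma delay_integral:
  fixes \<tau> m :: real
  assumes m: "m > 0" and \<tau>: "\<tau> \<ge> 0" "\<tau> * m < pi / 2"
  shows "has_bochner_integral lborel
    (\<lambda>x. 1 / (cmod (\<i> * of_real x + exp (- of_real \<tau> * (\<i> * of_real x)) * of_real m))\<^sup>2)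
    (pi * cos (\<tau> * m) / (m * (1 - sin (\<tau> * m))))"
proof -
  define f where "f x = 1 / (cmod (\<i> * of_real x + exp (- of_real \<tau> * (\<i> * of_real x)) * of_real m))\<^sup>2" for x
  define J where "J = pi * cos (\<tau> * m) / (1 - sin (\<tau> * m))"
  have "has_bochner_integral lborel (\<lambda>x. (1 / m\<^sup>2) * (1 / (cmod (delay_symbol (\<tau> * m) (\<i> * of_real x)))\<^sup>2)) ((1 / m\<^sup>2) * J)"
    unfolding J_def using m \<tau> by (intro has_bochner_integral_mult_right delay_integral_unit) auto
  also have "(\<lambda>x. (1 / m\<^sup>2) * (1 / (cmod (delay_symbol (\<tau> * m) (\<i> * of_real x)))\<^sup>2)) = (\<lambda>x. f (0 + m * x))"
  proof
    fix x
    have "\<i> * of_real (m * x) + exp (- of_real \<tau> * (\<i> * of_real (m * x))) * of_real m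
        = of_real m * delay_symbol (\<tau> * m) (\<i> * of_real x)"
      by (simp add: delay_symbol_def algebra_simps)
    then show "(1 / m\<^sup>2) * (1 / (cmod (delay_symbol (\<tau> * m) (\<i> * of_real x)))\<^sup>2) = f (0 + m * x)"
      unfolding f_def by (simp only: norm_mult add_0_left) (simp add: power_mult_distrib)
  qed
  also have "(1 / m\<^sup>2) * J = (J / m) /\<^sub>R \<bar>m\<bar>"
    using m by (simp add: power2_eq_square divide_simps)
  finally have "has_bochner_integral lborel f (J / m)"
    using m by (subst lborel_has_bochner_integral_real_affine_iff[of m _ _ 0]) auto
  then show ?thesis by (simp add: f_def[abs_def] J_def mult.commute)
qed

lemma delay_characteristic_nonzero:
  assumes "m > 0" "\<tau> \<ge> 0" "\<tau> * m < pi / 2" "Re s \<ge> 0"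
  shows "s + exp (- of_real \<tau> * s) * of_real m \<noteq> 0"
proof -
  have "s + exp (- of_real \<tau> * s) * of_real m = of_real m * delay_symbol (\<tau> * m) (s / of_real m)"
    using assms by (simp add: delay_symbol_def distrib_left mult.commute)
  moreover have "delay_symbol (\<tau> * m) (s / of_real m) \<noteq> 0"
    using assms by (intro delay_symbol_nonzero) (auto simp: Re_divide_of_real)
  ultimately show ?thesis using assms by simp
qed

section \<open>Functional calculus in an orthonormal frame\<close>

text \<open>The Penrose equations have at most one solution: transposing
  \<open>A X = (A Y)(A X)\<close> gives \<open>A X = A Y\<close>, likewise \<open>X A = Y A\<close>,
  and then \<open>X = X A X = Y A Y = Y\<close>.\<close>

lemma pinv_eqI:
  assumes "A ** X ** A = A" "X ** A ** X = X"
    "transpose (A ** X) = A ** X" "transpose (X ** A) = X ** A"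
  shows "pinv A = X"
  unfolding pinv_def
proof (rule the_equality)
  fix Y
  assume Y: "A ** Y ** A = A \<and> Y ** A ** Y = Y \<and>
    transpose (A ** Y) = A ** Y \<and> transpose (Y ** A) = Y ** A"
  have "A ** X = transpose ((A ** Y) ** (A ** X))"
    using assms Y by (simp add: matrix_mul_assoc)
  also have "\<dots> = A ** Y"
    using assms Y by (simp only: matrix_transpose_mul) (simp add: matrix_mul_assoc)
  finally have 1: "A ** X = A ** Y" .
  have "X ** A = transpose ((X ** A) ** (Y ** A))"
    using assms Y by (metis matrix_mul_assoc)
  also have "\<dots> = Y ** A"
    using assms Y by (simp only: matrix_transpose_mul) (metis matrix_mul_assoc)
  finally have 2: "X ** A = Y ** A" .
  show "Y = X"
    using 1 2 assms(2) Y by (metis matrix_mul_assoc)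
qed (use assms in auto)

lemma matrix_inv_eqI:
  fixes A :: "'a::semiring_1^'n^'n"
  assumes "A ** X = mat 1" "X ** A = mat 1"
  shows "matrix_inv A = X"
  unfolding matrix_inv_def
proof (rule some_equality)
  fix Y assume "A ** Y = mat 1 \<and> Y ** A = mat 1"
  then show "Y = X"
    using assms by (metis matrix_mul_assoc matrix_mul_lid matrix_mul_rid)
qed (use assms in auto)

section \<open>Matrices diagonal in a fixed orthonormal frame\<close>

locale orthonormal_frame =
  fixes B :: "(real^'n) set"
  assumes finite_frame: "finite B"
    and orthonormal: "b \<in> B \<Longrightarrow> c \<in> B \<Longrightarrow> b \<bullet> c = (if b = c then 1 else 0)"
    and expansion: "(\<Sum>b\<in>B. (x \<bullet> b) *\<^sub>R b) = x"
begin

text \<open>The matrix with eigenvalue \<open>f b\<close> on each frame vector \<open>b\<close>. The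
  frame is real but the values may be complex, so that \<open>eta\<close> and
  \<open>transfer\<close> share one calculus.\<close>

definition spec :: "(real^'n \<Rightarrow> 'a::real_field) \<Rightarrow> 'a^'n^'n" where
  "spec f = (\<chi> i j. \<Sum>b\<in>B. f b * of_real (b $ i * b $ j))"

lemma spec_nth: "spec f $ i $ j = (\<Sum>b\<in>B. f b * of_real (b $ i * b $ j))"
  by (simp add: spec_def)

lemma spec_cong: "(\<And>b. b \<in> B \<Longrightarrow> f b = g b) \<Longrightarrow> spec f = spec g"
  by (simp add: spec_def cong: sum.cong)

text \<open>Completeness of the frame: expanding \<open>axis i 1\<close> gives the resolution of the
  identity.\<close>

lemma spec_const: "spec (\<lambda>b. c) = mat c"
proof -
  have "(\<Sum>b\<in>B. b $ i * b $ j) = (if i = j then 1 else 0)" for i j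
  proof -
    have "(\<Sum>b\<in>B. b $ i * b $ j) = (\<Sum>b\<in>B. (axis i 1 \<bullet> b) *\<^sub>R b) $ j"
      by (simp add: inner_axis')
    also have "\<dots> = axis i 1 $ j" by (simp only: expansion)
    finally show ?thesis by (simp add: axis_def eq_commute)
  qed
  then have "(\<Sum>b\<in>B. c * of_real (b $ i * b $ j)) = (if i = j then c else 0)" for i j
    by (simp only: sum_distrib_left[symmetric] of_real_sum[symmetric]) simp
  then show ?thesis
    by (simp add: vec_eq_iff spec_nth mat_def)
qed

lemma spec_add: "spec f + spec g = spec (\<lambda>b. f b + g b)"
  by (simp add: vec_eq_iff spec_nth sum.distrib distrib_right)

lemma spec_diff: "spec f - spec g = spec (\<lambda>b. f b - g b)"
  by (simp add: vec_eq_iff spec_nth sum_subtractf left_diff_distrib)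

text \<open>Summing over the inner index produces \<open>b \<bullet> c\<close>, and orthonormality
  leaves only the diagonal terms.\<close>

lemma spec_mult: "spec f ** spec g = spec (\<lambda>b. f b * g b)"
proof -
  have "(spec f ** spec g) $ i $ k = spec (\<lambda>b. f b * g b) $ i $ k" for i k
  proof -
    have "(spec f ** spec g) $ i $ k =
        (\<Sum>j\<in>UNIV. \<Sum>b\<in>B. \<Sum>c\<in>B. f b * g c * of_real (b $ i * c $ k) * of_real (b $ j * c $ j))"
      by (simp add: matrix_matrix_mult_def spec_nth sum_product mult_ac)
    also have "\<dots> = (\<Sum>b\<in>B. \<Sum>c\<in>B. \<Sum>j\<in>UNIV. f b * g c * of_real (b $ i * c $ k) * of_real (b $ j * c $ j))"
      by (subst sum.swap) (simp add: sum.swap[of _ UNIV])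
    also have "\<dots> = (\<Sum>b\<in>B. \<Sum>c\<in>B. f b * g c * of_real (b $ i * c $ k) * of_real (b \<bullet> c))"
      by (simp only: sum_distrib_left[symmetric] of_real_sum[symmetric] inner_vec_def inner_real_def)
    also have "\<dots> = (\<Sum>b\<in>B. \<Sum>c\<in>B. if b = c then f b * g c * of_real (b $ i * c $ k) else 0)"
      by (intro sum.cong refl) (auto simp: orthonormal)
    also have "\<dots> = spec (\<lambda>b. f b * g b) $ i $ k"
      by (simp add: finite_frame spec_nth)
    finally show ?thesis .
  qed
  then show ?thesis by (simp add: vec_eq_iff)
qed

lemma transpose_spec: "transpose (spec f) = spec f"
  by (simp add: vec_eq_iff transpose_def spec_nth mult.commute)

lemma cmat_spec: "cmat (spec f) = spec (\<lambda>b. of_real (f b))"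
  by (simp add: vec_eq_iff cmat_def spec_nth)

lemma conj_transpose_spec: "conj_transpose (spec f) = spec (\<lambda>b. cnj (f b))"
  by (simp add: vec_eq_iff conj_transpose_def spec_nth mult.commute)

lemma scaleR_spec: "(c::real) *\<^sub>R spec f = spec (\<lambda>b. c * f b)"
  by (simp add: vec_eq_iff spec_nth sum_distrib_left mult.assoc)

lemma mpow_spec: "mpow (spec f) k = spec (\<lambda>b. f b ^ k)"
  by (induction k) (simp_all add: spec_const spec_mult)

lemma spec_sums:
  fixes f :: "nat \<Rightarrow> real^'n \<Rightarrow> real"
  assumes "\<And>b. b \<in> B \<Longrightarrow> (\<lambda>k. f k b) sums g b"
  shows "(\<lambda>k. spec (f k)) sums spec g"
proof -
  \<comment> \<open>As a finite combination of fixed rank-one matrices, \<open>spec\<close> inherits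
    convergence from its coefficients.\<close>
  have eq: "spec h = (\<Sum>b\<in>B. h b *\<^sub>R outer b b)" for h :: "real^'n \<Rightarrow> real"
    by (simp add: vec_eq_iff spec_nth outer_def)
  show ?thesis
    unfolding eq
    by (intro sums_sum bounded_linear.sums[OF bounded_linear_scaleR_left] assms)
qed

lemma mat_cos_spec: "mat_cos (spec f) = spec (\<lambda>b. cos (f b))"
proof -
  have "(\<lambda>k. spec (\<lambda>b. (- 1) ^ k / fact (2 * k) * f b ^ (2 * k))) sums spec (\<lambda>b. cos (f b))"
    by (intro spec_sums) (use cos_paired in \<open>auto\<close>)
  then show ?thesis
    by (simp add: mat_cos_def mpow_spec scaleR_spec sums_iff)
qed

lemma mat_sin_spec: "mat_sin (spec f) = spec (\<lambda>b. sin (f b))"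
proof -
  have "(\<lambda>k. spec (\<lambda>b. (- 1) ^ k / fact (2 * k + 1) * f b ^ (2 * k + 1))) sums spec (\<lambda>b. sin (f b))"
    by (intro spec_sums) (use sin_paired in \<open>auto\<close>)
  then show ?thesis
    unfolding mat_sin_def mpow_spec scaleR_spec by (simp only: sums_iff)
qed

text \<open>The convention \<open>inverse 0 = 0\<close> makes \<open>inverse\<close> the scalar
  pseudo-inverse, so zero eigenvalues need no separate treatment.\<close>

lemma pinv_spec: "pinv (spec f) = spec (\<lambda>b. inverse (f b))"
proof -
  have "f b * inverse (f b) * f b = f b" "inverse (f b) * f b * inverse (f b) = inverse (f b)" for b
    by (cases "f b = 0"; simp)+
  then show ?thesis
    by (intro pinv_eqI) (simp_all only: spec_mult transpose_spec)
qed

lemma matrix_inv_spec: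
  assumes "\<And>b. b \<in> B \<Longrightarrow> f b \<noteq> 0"
  shows "matrix_inv (spec f) = spec (\<lambda>b. inverse (f b))"
proof -
  have "spec f ** spec (\<lambda>b. inverse (f b)) = mat 1" "spec (\<lambda>b. inverse (f b)) ** spec f = mat 1"
    unfolding spec_mult spec_const[symmetric] using assms by (auto intro!: spec_cong)
  then show ?thesis by (rule matrix_inv_eqI)
qed

text \<open>A matrix is determined by its action on the frame; this brings the Laplacian and
  \<open>Mc\<close> into the calculus.\<close>

lemma eq_specI:
  fixes M :: "real^'n^'n"
  assumes "\<And>b. b \<in> B \<Longrightarrow> M *v b = f b *\<^sub>R b"
  shows "M = spec f"
proof -
  have spec: "spec f *v x = (\<Sum>b\<in>B. (x \<bullet> b) *\<^sub>R f b *\<^sub>R b)" for x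
  proof -
    have "(spec f *v x) $ i = (\<Sum>b\<in>B. (x \<bullet> b) *\<^sub>R f b *\<^sub>R b) $ i" for i
    proof -
      have "(spec f *v x) $ i = (\<Sum>j\<in>UNIV. \<Sum>b\<in>B. f b * b $ i * (x $ j * b $ j))"
        by (simp add: matrix_vector_mult_def spec_nth sum_distrib_right) (simp only: mult_ac)
      also have "\<dots> = (\<Sum>b\<in>B. f b * b $ i * (x \<bullet> b))"
        by (subst sum.swap) (simp add: inner_vec_def sum_distrib_left)
      finally show ?thesis by (simp add: mult_ac)
    qed
    then show ?thesis by (simp add: vec_eq_iff)
  qed
  have "M *v x = spec f *v x" for x
  proof -
    have "M *v (\<Sum>b\<in>B. (x \<bullet> b) *\<^sub>R b) = (\<Sum>b\<in>B. (x \<bullet> b) *\<^sub>R (M *v b))"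
      by (simp add: linear_sum[OF matrix_vector_mul_linear] matrix_vector_mult_scaleR)
    then show ?thesis by (simp add: expansion spec assms)
  qed
  then show ?thesis by (simp add: matrix_eq)
qed

text \<open>The diagonal factor scales column \<open>i\<close> by \<open>\<sigma> $ i\<close>, so
  the trace splits into node contributions linear in the intensities, weighted by the diagonal of
  the Gram matrix of \<open>spec k\<close>.\<close>

lemma trace_gram_spec_diag:
  fixes k :: "real^'n \<Rightarrow> complex" and \<sigma> :: "real^'n"
  defines "T \<equiv> spec k ** (\<chi> i j. if i = j then complex_of_real (\<sigma> $ i) else 0)"
  shows "Re (trace (conj_transpose T ** T)) = (\<Sum>i\<in>UNIV. (\<sigma> $ i)\<^sup>2 * (\<Sum>b\<in>B. (cmod (k b))\<^sup>2 * (b $ i)\<^sup>2))"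
proof -
  have T: "T $ i $ j = spec k $ i $ j * of_real (\<sigma> $ j)" for i j
    by (simp add: T_def matrix_matrix_mult_def if_distrib cong: if_cong)
  have "(conj_transpose T ** T) $ i $ i = of_real ((\<sigma> $ i)\<^sup>2) * (conj_transpose (spec k) ** spec k) $ i $ i" for i
    by (simp add: matrix_matrix_mult_def conj_transpose_def T sum_distrib_left power2_eq_square mult_ac)
  also have "\<dots> i = of_real ((\<sigma> $ i)\<^sup>2) * of_real (\<Sum>b\<in>B. (cmod (k b))\<^sup>2 * (b $ i)\<^sup>2)" for i
    unfolding conj_transpose_spec spec_mult spec_nth
    by (simp add: complex_norm_square[symmetric] mult.commute[of "cnj _"] power2_eq_square[of "b $ i" for b :: "real^'n" and i])
  finally show ?thesis
    by (simp add: trace_def)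
qed

end

section \<open>Weighted Laplacians\<close>

lemma cmat_Mc: "cmat Mc = (Mc :: complex^'n^'n)"
  by (simp add: vec_eq_iff cmat_def Mc_def mat_def)

lemma Mc_mult_vec: "(Mc *v (x :: real^'n)) $ i = x $ i - (x \<bullet> 1) / real CARD('n)"
  by (simp add: Mc_def matrix_vector_mult_diff_rdistrib)
     (simp add: matrix_vector_mult_def inner_vec_def sum_divide_distrib)

text \<open>The choice operator fixes an unknown orientation, hence the disjunction. Its uses only
  concern whether the product vanishes.\<close>

lemma edge_vec_inner:
  assumes "i \<noteq> j"
  shows "edge_vec {i, j} \<bullet> x = x $ i - x $ j \<or> edge_vec {i, j} \<bullet> x = x $ j - x $ i"
proof -
  define p where "p = (SOME (k, l). k \<noteq> l \<and> {i, j} = {k, l})"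
  obtain k l where kl: "p = (k, l)" by (cases p)
  have "case p of (k, l) \<Rightarrow> k \<noteq> l \<and> {i, j} = {k, l}"
    unfolding p_def by (rule someI[of _ "(i, j)"]) (use assms in simp)
  then have "k = i \<and> l = j \<or> k = j \<and> l = i"
    by (simp add: kl doubleton_eq_iff) blast
  then show ?thesis
    unfolding edge_vec_def p_def[symmetric] kl by (auto simp: inner_diff_left inner_axis')
qed

lemma Lap_mult_vec:
  fixes x :: "real^'a"
  shows "Lap E w *v x = (\<Sum>e\<in>E. (w e * (edge_vec e \<bullet> x)) *\<^sub>R edge_vec e)"
proof -
  have "outer u u *v x = (u \<bullet> x) *\<^sub>R u" for u
    by (simp add: vec_eq_iff outer_def matrix_vector_mult_def inner_vec_def sum_distrib_left mult_ac)
  moreover have "(\<Sum>e\<in>E. M e) *v x = (\<Sum>e\<in>E. M e *v x)" for M :: "'a set \<Rightarrow> real^'a^'a"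
    by (induction E rule: infinite_finite_induct) (auto simp: matrix_vector_mult_add_rdistrib)
  ultimately show ?thesis
    by (simp add: Lap_def scaleR_matrix_vector_assoc[symmetric])
qed

lemma Lap_self_adjoint: "(Lap E w *v x) \<bullet> y = x \<bullet> (Lap E w *v y)"
  by (simp add: Lap_mult_vec inner_sum_left inner_sum_right inner_commute[of x] mult_ac)

lemma Lap_quadratic_form: "x \<bullet> (Lap E w *v x) = (\<Sum>e\<in>E. w e * (edge_vec e \<bullet> x)\<^sup>2)"
  by (simp add: Lap_mult_vec inner_sum_right inner_commute[of x] power2_eq_square mult_ac)

lemma Lap_mult_ones:
  assumes "simple_graph E"
  shows "Lap E w *v 1 = 0"
proof -
  have "edge_vec e \<bullet> 1 = 0" if e: "e \<in> E" for e
  proof -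
    obtain i j where "i \<noteq> j" "e = {i, j}" using assms e unfolding simple_graph_def by blast
    then show ?thesis using edge_vec_inner[of i j 1] by auto
  qed
  then show ?thesis by (simp add: Lap_mult_vec)
qed

text \<open>The quadratic form is a positively weighted sum of squared edge differences. If it
  vanishes, \<open>x\<close> agrees across every edge and therefore along every path.\<close>

lemma Lap_kernel_constant:
  fixes x :: "real^'n"
  assumes simple: "simple_graph E" and conn: "connected_graph E" and pos: "\<forall>e\<in>E. w e > 0"
    and ker: "Lap E w *v x = 0"
  shows "x $ i = x $ j"
proof -
  have "(\<Sum>e\<in>E. w e * (edge_vec e \<bullet> x)\<^sup>2) = 0"
    using Lap_quadratic_form[of x E w] ker by simp
  then have zero: "edge_vec e \<bullet> x = 0" if "e \<in> E" for e
    using pos that by (subst (asm) sum_nonneg_eq_0_iff) (force simp: less_imp_le)+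
  have step: "x $ k = x $ l" if "{k, l} \<in> E" for k l
    using edge_vec_inner[of k l x] zero[OF that] by (cases "k = l") auto
  have "(\<lambda>a b. {a, b} \<in> E)\<^sup>*\<^sup>* i j" using conn by (simp add: connected_graph_def)
  then show ?thesis by induction (auto dest: step)
qed

text \<open>\<open>Max\<close> is meaningful only for a finite set. Any eigenvector has a nonzero
  component along some \<open>b\<close>, and self-adjointness then forces its eigenvalue to be
  \<open>\<mu> b\<close>, so the spectrum is finite.\<close>

lemma eigenvalue_le_lambda_max:
  fixes A :: "real^'n^'n"
  assumes adj: "\<And>x y. (A *v x) \<bullet> y = x \<bullet> (A *v y)" and v: "v \<noteq> 0" "A *v v = l *\<^sub>R v"
  shows "l \<le> lambda_max A"
proof -
  obtain B \<mu> where fin: "finite B"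
    and "\<And>b c. b \<in> B \<Longrightarrow> c \<in> B \<Longrightarrow> b \<bullet> c = (if b = c then 1 else 0)"
    and eig: "\<And>b. b \<in> B \<Longrightarrow> A *v b = \<mu> b *\<^sub>R b"
    and expand: "\<And>x. (\<Sum>b\<in>B. (x \<bullet> b) *\<^sub>R b) = x"
    using self_adjoint_orthonormal_eigenbasis[of "(*v) A", OF matrix_vector_mul_linear] adj by blast
  have "{l. \<exists>v. v \<noteq> 0 \<and> A *v v = l *\<^sub>R v} \<subseteq> \<mu> ` B"
  proof clarify
    fix l v assume v: "(v :: real^'n) \<noteq> 0" "A *v v = l *\<^sub>R v"
    obtain b where b: "b \<in> B" "v \<bullet> b \<noteq> 0"
      using expand[of v] v(1) by (metis (no_types, lifting) scaleR_zero_left sum.neutral)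
    have "l * (v \<bullet> b) = \<mu> b * (v \<bullet> b)"
      using adj[of v b] v(2) eig[OF b(1)] by simp
    then show "l \<in> \<mu> ` B" using b by simp
  qed
  then have "finite {l. \<exists>v. v \<noteq> 0 \<and> A *v v = l *\<^sub>R v}"
    using fin finite_surj by blast
  then show ?thesis
    unfolding lambda_max_def using v by (intro Max_ge) auto
qed

section \<open>The performance as a linear form in the noise intensities, and its worst case\<close>

lemma rho_ss_eq_sum_eta:
  fixes E :: "('n::finite) set set"
  assumes simple: "simple_graph E" and conn: "connected_graph E" and \<tau>: "\<tau> \<ge> 0"
    and adm: "admissible E \<tau> w"
  shows "rho_ss (Lap E w) \<tau> \<sigma> = (\<Sum>i\<in>UNIV. (\<sigma> $ i)\<^sup>2 * eta E \<tau> w i)"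
proof -
  define L where "L = Lap E w"
  have pos: "\<forall>e\<in>E. w e > 0" and lam: "\<tau> * lambda_max L < pi / 2"
    using adm by (auto simp: admissible_def L_def)
  obtain B \<mu> where "finite B"
    and ortho: "\<And>b c. b \<in> B \<Longrightarrow> c \<in> B \<Longrightarrow> b \<bullet> c = (if b = c then 1 else 0)"
    and eig: "\<And>b. b \<in> B \<Longrightarrow> L *v b = \<mu> b *\<^sub>R b"
    and "\<And>x. (\<Sum>b\<in>B. (x \<bullet> b) *\<^sub>R b) = x"
    using self_adjoint_orthonormal_eigenbasis[of "(*v) L", OF matrix_vector_mul_linear]
      Lap_self_adjoint[of E w] unfolding L_def by blast
  then interpret orthonormal_frame B by unfold_locales
  have nonneg: "\<mu> b \<ge> 0" if "b \<in> B" for b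
  proof -
    have "\<mu> b = b \<bullet> (L *v b)" using eig[OF that] ortho[OF that that] by simp
    also have "\<dots> \<ge> 0"
      unfolding L_def Lap_quadratic_form using pos by (intro sum_nonneg) (auto simp: less_imp_le)
    finally show ?thesis .
  qed
  \<comment> \<open>Admissibility bounds the top eigenvalue, which puts every mode in the range of
    the scalar integral.\<close>
  have small: "\<tau> * \<mu> b < pi / 2" if "b \<in> B" for b
  proof -
    have "b \<noteq> 0" using ortho[OF that that] by auto
    then have "\<mu> b \<le> lambda_max L"
      using eig[OF that] Lap_self_adjoint unfolding L_def by (intro eigenvalue_le_lambda_max) auto
    then show ?thesis using lam \<tau> mult_left_mono by fastforce
  qed
  \<comment> \<open>The spectrum of \<open>Mc\<close>: null modes are constant vectors by
    connectedness and are removed by centring, while the other modes are orthogonal to the ones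
    vector and kept.\<close>
  define p :: "real^'n \<Rightarrow> real" where "p b = (if \<mu> b = 0 then 0 else 1)" for b
  have L: "L = spec \<mu>" using eig by (rule eq_specI)
  have Mc: "Mc = spec p"
  proof (rule eq_specI)
    fix b assume b: "b \<in> B"
    show "Mc *v b = p b *\<^sub>R b"
    proof (cases "\<mu> b = 0")
      case True
      then have "L *v b = 0" using eig[OF b] by simp
      then have const: "b $ j = b $ i" for i j
        using Lap_kernel_constant[OF simple conn pos] unfolding L_def by blast
      have "b \<bullet> 1 / real CARD('n) = b $ i" for i
      proof -
        have "b \<bullet> 1 = (\<Sum>j\<in>(UNIV :: 'n set). b $ i)"
          unfolding inner_vec_def using const[of _ i] by (intro sum.cong) simp_all
        then show ?thesis by simp
      qed
      then show ?thesis using True by (simp add: vec_eq_iff Mc_mult_vec p_def)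
    next
      case False
      have "\<mu> b * (b \<bullet> 1) = (L *v b) \<bullet> 1" by (simp add: eig[OF b])
      also have "\<dots> = 0" unfolding L_def Lap_self_adjoint Lap_mult_ones[OF simple] by simp
      finally show ?thesis using False by (simp add: vec_eq_iff Mc_mult_vec p_def)
    qed
  qed
  \<comment> \<open>\<open>V b / 2\<close> is the coefficient of mode \<open>b\<close> in
    \<open>eta\<close>, and \<open>pi * V b\<close> will be its frequency integral. On null modes
    \<open>inverse 0 = 0\<close> makes it vanish.\<close>
  define V where "V b = inverse (\<mu> b) * cos (\<tau> * \<mu> b) * inverse (p b - sin (\<tau> * \<mu> b))" for b
  have eta: "eta E \<tau> w i = 1 / 2 * (\<Sum>b\<in>B. V b * (b $ i)\<^sup>2)" for i
    unfolding eta_def Let_def L_def[symmetric] L Mc scaleR_spec mat_cos_spec mat_sin_spec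
      spec_diff pinv_spec spec_mult
    by (simp add: spec_nth V_def power2_eq_square[of "b $ i" for b :: "real^'n" and i])
  define H where "H x b = \<i> * complex_of_real x + exp (- of_real \<tau> * (\<i> * of_real x)) * of_real (\<mu> b)" for x b
  define g where "g x b = (if \<mu> b = 0 then 0 else 1 / (cmod (H x b))\<^sup>2)" for x b
  let ?T = "\<lambda>x. transfer L \<tau> \<sigma> (\<i> * of_real x)"
  \<comment> \<open>At \<open>x = 0\<close> a null mode makes the matrix to be inverted singular;
    this single frequency is later discarded as a null set.\<close>
  have T: "Re (trace (conj_transpose (?T x) ** ?T x)) = (\<Sum>i\<in>UNIV. (\<sigma> $ i)\<^sup>2 * (\<Sum>b\<in>B. g x b * (b $ i)\<^sup>2))"
    if x: "x \<noteq> 0" for x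
  proof -
    have nz: "H x b \<noteq> 0" if "b \<in> B" for b
    proof (cases "\<mu> b = 0")
      case False
      then show ?thesis
        unfolding H_def using nonneg[OF that] small[OF that] \<tau>
        by (intro delay_characteristic_nonzero) auto
    qed (simp add: H_def x)
    have "mat (\<i> * of_real x) + mat (exp (- of_real \<tau> * (\<i> * of_real x))) ** cmat L = spec (H x)"
      unfolding L cmat_spec spec_const[symmetric] spec_mult spec_add by (simp add: H_def[abs_def])
    then have "?T x = spec (\<lambda>b. of_real (p b) * inverse (H x b)) ** (\<chi> i j. if i = j then complex_of_real (\<sigma> $ i) else 0)"
      unfolding transfer_def cmat_Mc[symmetric] Mc cmat_spec
      by (simp only: matrix_inv_spec[OF nz] spec_mult)
    moreover have "(cmod (of_real (p b) * inverse (H x b)))\<^sup>2 = g x b" for b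
      by (simp add: p_def g_def norm_inverse power_inverse norm_mult inverse_eq_divide power_divide norm_divide)
    ultimately show ?thesis by (simp only: trace_gram_spec_diag)
  qed
  have "has_bochner_integral lborel (\<lambda>x. g x b) (pi * V b)" if b: "b \<in> B" for b
  proof (cases "\<mu> b = 0")
    case False
    then show ?thesis
      using delay_integral[of "\<mu> b" \<tau>] nonneg[OF b] small[OF b] \<tau>
      by (simp add: g_def H_def V_def p_def field_simps)
  qed (simp add: g_def V_def has_bochner_integral_zero)
  then have "has_bochner_integral lborel (\<lambda>x. \<Sum>i\<in>UNIV. (\<sigma> $ i)\<^sup>2 * (\<Sum>b\<in>B. g x b * (b $ i)\<^sup>2))
      (\<Sum>i\<in>UNIV. (\<sigma> $ i)\<^sup>2 * (\<Sum>b\<in>B. pi * V b * (b $ i)\<^sup>2))"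
    by (intro has_bochner_integral_sum has_bochner_integral_mult_right has_bochner_integral_mult_left) auto
  then have "(LINT x|lborel. (\<Sum>i\<in>UNIV. (\<sigma> $ i)\<^sup>2 * (\<Sum>b\<in>B. g x b * (b $ i)\<^sup>2))) =
      (\<Sum>i\<in>UNIV. (\<sigma> $ i)\<^sup>2 * (\<Sum>b\<in>B. pi * V b * (b $ i)\<^sup>2))"
    by (rule has_bochner_integral_integral_eq)
  moreover have "(LINT x|lborel. Re (trace (conj_transpose (?T x) ** ?T x))) =
      (LINT x|lborel. (\<Sum>i\<in>UNIV. (\<sigma> $ i)\<^sup>2 * (\<Sum>b\<in>B. g x b * (b $ i)\<^sup>2)))"
    by (rule integral_discrete_difference[where X = "{0}"]) (auto simp: T)
  ultimately have "rho_ss L \<tau> \<sigma> = 1 / (2 * pi) * (\<Sum>i\<in>UNIV. (\<sigma> $ i)\<^sup>2 * (\<Sum>b\<in>B. pi * V b * (b $ i)\<^sup>2))"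
    by (simp add: rho_ss_def)
  also have "\<dots> = (\<Sum>i\<in>UNIV. (\<sigma> $ i)\<^sup>2 * eta E \<tau> w i)"
    by (simp add: eta sum_distrib_left mult_ac)
  finally show ?thesis by (simp add: L_def)
qed

lemma worst_rho_eq_worst_eta:
  fixes E :: "('n::finite) set set"
  assumes "simple_graph E" "connected_graph E" "\<tau> \<ge> 0" "admissible E \<tau> w"
  shows "worst_rho E \<tau> w = real CARD('n) * worst_eta E \<tau> w"
  unfolding worst_rho_def
proof (rule cSup_eq_maximum)
  note rho = rho_ss_eq_sum_eta[OF assms]
  have le: "eta E \<tau> w i \<le> worst_eta E \<tau> w" for i
    by (simp add: worst_eta_def)
  have "worst_eta E \<tau> w \<in> range (eta E \<tau> w)"
    unfolding worst_eta_def by (intro Max_in) auto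
  then obtain k where k: "eta E \<tau> w k = worst_eta E \<tau> w" by auto
  \<comment> \<open>All the power goes to a node of largest centrality. The square root is there
    because the budget constrains the squares.\<close>
  define \<sigma> :: "real^'n" where "\<sigma> = axis k (sqrt (real CARD('n)))"
  have \<sigma>: "(\<sigma> $ i)\<^sup>2 = (if i = k then real CARD('n) else 0)" for i
    by (simp add: \<sigma>_def axis_def)
  have "\<forall>i. \<sigma> $ i \<ge> 0" by (simp add: \<sigma>_def axis_def)
  moreover have "(\<Sum>i\<in>UNIV. (\<sigma> $ i)\<^sup>2) = real CARD('n)" by (simp add: \<sigma>)
  moreover have "rho_ss (Lap E w) \<tau> \<sigma> = real CARD('n) * worst_eta E \<tau> w"
    by (simp add: rho \<sigma> k if_distrib[of "\<lambda>x. x * _"] cong: if_cong)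
  ultimately show "real CARD('n) * worst_eta E \<tau> w \<in> {rho_ss (Lap E w) \<tau> \<sigma> | \<sigma>.
      (\<forall>i. \<sigma> $ i \<ge> 0) \<and> (\<Sum>i\<in>UNIV. (\<sigma> $ i)\<^sup>2) = real CARD('n)}"
    by (intro CollectI exI[of _ \<sigma>]) simp
  fix r assume "r \<in> {rho_ss (Lap E w) \<tau> \<sigma> | \<sigma>.
      (\<forall>i. \<sigma> $ i \<ge> 0) \<and> (\<Sum>i\<in>UNIV. (\<sigma> $ i)\<^sup>2) = real CARD('n)}"
  then obtain \<sigma> :: "real^'n" where s: "r = rho_ss (Lap E w) \<tau> \<sigma>" "(\<Sum>i\<in>UNIV. (\<sigma> $ i)\<^sup>2) = real CARD('n)"
    by auto
  have "r \<le> (\<Sum>i\<in>UNIV. (\<sigma> $ i)\<^sup>2 * worst_eta E \<tau> w)"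
    unfolding s(1) rho by (intro sum_mono mult_left_mono le) auto
  then show "r \<le> real CARD('n) * worst_eta E \<tau> w"
    by (simp add: s(2) sum_distrib_right[symmetric])
qed

theorem theorem14:
  fixes E :: "('n::finite) set set" and \<tau> :: real and w :: "'n set \<Rightarrow> real"
  assumes "simple_graph E" and "connected_graph E" and "\<tau> \<ge> 0"
    and "admissible E \<tau> w"
  shows "optimal_P1 E \<tau> w \<longleftrightarrow> optimal_P2 E \<tau> w"
  \<comment> \<open>The proportionality holds for every admissible competitor with the same positive
    factor \<open>CARD('n)\<close>, so both objectives order admissible weights alike.\<close>
  using assms worst_rho_eq_worst_eta[OF assms(1-3)]
  by (auto simp: optimal_P1_def optimal_P2_def)

end
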